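(* Given a classical noncrossing partition $\mathcal{P}=\{\mathcal{B}_1,\dots,\mathcal{B}_m\}$ of $[n]=\{1,\dots,n\}$, where $1\in\mathcal{B}_1$, let $f(\mathcal{P})$ be the partition $\{\mathcal{B}_1',\dots,\mathcal{B}_m'\}$ of $[n+1]$ defined by $\mathcal{B}_1'=\mathcal{B}_1\cup\{n+1\}$ and $\mathcal{B}_i'=\mathcal{B}_i$ for $i\neq 1$. Then $f(\mathcal{P})$ is a positive noncrossing partition, and $f:NC(n)\to NC^+(n+1)$ is a bijection, where $NC^+(n+1)$ is the image of $NC^+(A_n)$ under the isomorphism between $NC(A_n)$ and $NC(n+1)$.
   Context: A classical noncrossing partition of $[m]=\{1,\dots,m\}$ is a set partition of $[m]$ such that whenever $1\leq a<b<c<d\leq m$ with $a,c$ in a block $\mathcal{B}_i$ and $b,d$ in a block $\mathcal{B}_j$, then $\mathcal{B}_i=\mathcal{B}_j$. The set of these is denoted $NC(m)$. Let $W=\mathfrak{S}_{n+1}$ be the Coxeter group of type $A_n$, with simple generators $s_i=(i\ i+1)$, $1\leq i\leq n$, with reflections $T$ = all transpositions, and with Coxeter element $c=s_1s_2\cdots s_n=(1\ 2\ \cdots\ n+1)$. Let $l_T(w)$ be the minimal length of $w$ as a product of reflections, and put $u\leq_T v$ iff $l_T(v)=l_T(u)+l_T(u^{-1}v)$. $NC(A_n)$ is the set of $w\in W$ with $1\leq_T w\leq_T c$. The isomorphism $NC(A_n)\to NC(n+1)$ (Biane) sends a permutation to the set partition of $[n+1]$ given by its disjoint cycles (including $1$-cycles).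 $NC^+(A_n)$ is the set of positive elements of $NC(A_n)$, i.e. those not contained in any proper standard parabolic subgroup (a subgroup generated by a proper subset of $\{s_1,\dots,s_n\}$). A classical noncrossing partition of $[n+1]$ is called positive if it lies in the image of $NC^+(A_n)$. *)

theory Defs
  imports "HOL-Algebra.Sym_Groups" "HOL-Combinatorics.Orbits" "HOL-Library.Disjoint_Sets"
begin

definition noncrossing :: "nat set set \<Rightarrow> bool" where
  "noncrossing P \<longleftrightarrow>
     (\<forall>a b c d. \<forall>B\<in>P. \<forall>B'\<in>P.
        a < b \<and> b < c \<and> c < d \<and> a \<in> B \<and> c \<in> B \<and> b \<in> B' \<and> d \<in> B' \<longrightarrow> B = B')"

definition NC :: "nat \<Rightarrow> nat set set set" where
  "NC m = {P. partition_on {1..m} P \<and> noncrossing P}"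

definition W_A :: "nat \<Rightarrow> (nat \<Rightarrow> nat) monoid" where
  "W_A n = sym_group (n + 1)"

definition simple_gen :: "nat \<Rightarrow> nat \<Rightarrow> nat" where
  "simple_gen i = Transposition.transpose i (i + 1)"

definition simple_gens_A :: "nat \<Rightarrow> (nat \<Rightarrow> nat) set" where
  "simple_gens_A n = simple_gen ` {1..n}"

definition reflections_A :: "nat \<Rightarrow> (nat \<Rightarrow> nat) set" where
  "reflections_A n = {Transposition.transpose i j | i j. 1 \<le> i \<and> i < j \<and> j \<le> n + 1}"

definition word_prod :: "('a, 'b) monoid_scheme \<Rightarrow> 'a list \<Rightarrow> 'a" where
  "word_prod G ws = foldr (mult G) ws (one G)"

text \<open>Multiplication is composition of functions, the right factor acting first. With this
  convention \<open>s\<^sub>1 \<cdots> s\<^sub>n\<close> is the cycle \<open>1 \<mapsto> 2 \<mapsto> \<cdots> \<mapsto> n + 1 \<mapsto> 1\<close>.\<close>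

definition coxeter_elt_A :: "nat \<Rightarrow> nat \<Rightarrow> nat" where
  "coxeter_elt_A n = word_prod (W_A n) (map simple_gen [1..<n + 1])"

text \<open>The minimum is meaningful only for elements of the subgroup generated by \<open>T\<close>.\<close>

definition reflection_length :: "('a, 'b) monoid_scheme \<Rightarrow> 'a set \<Rightarrow> 'a \<Rightarrow> nat" where
  "reflection_length G T w = (LEAST k. \<exists>ws. set ws \<subseteq> T \<and> length ws = k \<and> word_prod G ws = w)"

definition absolute_le :: "('a, 'b) monoid_scheme \<Rightarrow> 'a set \<Rightarrow> 'a \<Rightarrow> 'a \<Rightarrow> bool" where
  "absolute_le G T u v \<longleftrightarrow>
     reflection_length G T v
       = reflection_length G T u + reflection_length G T (inv\<^bsub>G\<^esub> u \<otimes>\<^bsub>G\<^esub> v)"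

definition NC_A :: "nat \<Rightarrow> (nat \<Rightarrow> nat) set" where
  "NC_A n = {w \<in> carrier (W_A n).
     absolute_le (W_A n) (reflections_A n) \<one>\<^bsub>W_A n\<^esub> w \<and>
     absolute_le (W_A n) (reflections_A n) w (coxeter_elt_A n)}"

definition NC_pos_A :: "nat \<Rightarrow> (nat \<Rightarrow> nat) set" where
  "NC_pos_A n = {w \<in> NC_A n. \<forall>J. J \<subset> simple_gens_A n \<longrightarrow> w \<notin> generate (W_A n) J}"

text \<open>The orbit of a fixed point \<open>i\<close> is \<open>{i}\<close>, so cycles of length one are included.\<close>

definition cycle_partition :: "nat \<Rightarrow> (nat \<Rightarrow> nat) \<Rightarrow> nat set set" where
  "cycle_partition m w = orbit w ` {1..m}"

text \<open>Indexed by the size \<open>m\<close> of the ground set, whose Coxeter group has rank \<open>m - 1\<close>;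
  only \<open>m \<ge> 1\<close> is meaningful.\<close>

definition NC_pos :: "nat \<Rightarrow> nat set set set" where
  "NC_pos m = cycle_partition m ` NC_pos_A (m - 1)"

definition add_to_first_block :: "nat \<Rightarrow> nat set set \<Rightarrow> nat set set" where
  "add_to_first_block n P = (\<lambda>B. if 1 \<in> B then B \<union> {n + 1} else B) ` P"

end

theory Submission imports Defs begin

text \<open>Multiplying a permutation by a transposition changes its number of cycles by at most one, so
  the reflection length of \<open>w\<close> is \<open>n + 1\<close> minus the number of its cycles, and \<open>w\<close> lies below the
  Coxeter element \<open>c\<close> iff \<open>w\<close> and \<open>w\<^sup>-\<^sup>1c\<close> together have \<open>n + 2\<close> cycles. Lower bounds for
  the number of cycles come from functions that are invariant under the permutation: the cycles are
  at least as many as the values of such a function. In this way the cycle partitions of the elements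
  below \<open>c\<close> are seen to be exactly the noncrossing partitions. Such an element is positive iff 1 and
  \<open>n + 1\<close> share a cycle, since otherwise no cycle crosses the gap behind the maximum of the cycle
  of 1. Deleting \<open>n + 1\<close> from the block of 1 therefore inverts the map of the theorem.\<close>

section \<open>Orbits, invariant functions and the number of cycles\<close>

lemma permutes_permutation:
  fixes N :: nat
  assumes "w permutes {1..N}"
  shows "permutation w"
  using assms by (auto simp: permutation_permutes)

lemma orbit_eq_iff:
  assumes "permutation w"
  shows "orbit w x = orbit w y \<longleftrightarrow> x \<in> orbit w y"
  using assms by (metis cyclic_on_orbit' orbit_cyclic_eq3 permutation_self_in_orbit)

lemma orbit_invariant:
  assumes "\<And>x. f (w x) = f x" and "y \<in> orbit w x"
  shows "f y = f x"
  using assms(2) by induction (auto simp: assms(1))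

text \<open>An injective self-map of a finite set is onto, so no point outside \<open>A\<close> can
  be sent into \<open>A\<close>. This turns membership in a stable set into an invariant
  function.\<close>

lemma stable_set_iff:
  assumes "inj w" "finite A" "w ` A \<subseteq> A"
  shows "w x \<in> A \<longleftrightarrow> x \<in> A"
proof -
  have "w ` A = A"
    using assms by (intro endo_inj_surj) (auto intro: inj_on_subset)
  with \<open>inj w\<close> show ?thesis by (metis inj_image_mem_iff)
qed

text \<open>An invariant function collapses each orbit to one value, so it factors through the set
  of cycles.\<close>

lemma card_invariant_le_cycles:
  assumes "\<And>x. f (w x) = f x"
  shows "card (f ` {1..N}) \<le> card (cycle_partition N w)"
proof -
  have "f ` orbit w x = {f x}" for x
    using orbit_invariant[of f, OF assms] orbit_nonempty[of w x] by auto
  then have "f ` {1..N} = (\<lambda>C. the_elem (f ` C)) ` cycle_partition N w"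
    by (auto simp: cycle_partition_def image_image)
  then show ?thesis
    by (simp add: card_image_le cycle_partition_def)
qed

text \<open>The function that gives \<open>x\<close> its cycle, with the cycles of \<open>i\<close>
  and \<open>j\<close> identified, is invariant under both \<open>w\<close> and the transposition,
  hence under their product. The identification loses at most one value.\<close>

lemma cycles_transpose_ge:
  assumes "permutation w"
  shows "card (cycle_partition N w)
    \<le> Suc (card (cycle_partition N (Transposition.transpose i j \<circ> w)))"
proof -
  define f where "f x = (if orbit w x = orbit w j then orbit w i else orbit w x)" for x
  have "f (Transposition.transpose i j y) = f y" for y
    by (auto simp: f_def Transposition.transpose_def)
  moreover have "f (w x) = f x" for x
    by (simp add: f_def permutation_orbit_step[OF assms])
  ultimately have "card (f ` {1..N})
      \<le> card (cycle_partition N (Transposition.transpose i j \<circ> w))"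
    by (intro card_invariant_le_cycles) simp
  moreover have "cycle_partition N w - {orbit w j} \<subseteq> f ` {1..N}"
    by (auto simp: cycle_partition_def f_def)
  then have "card (cycle_partition N w - {orbit w j}) \<le> card (f ` {1..N})"
    by (intro card_mono) auto
  moreover have "card (cycle_partition N w) \<le> Suc (card (cycle_partition N w - {orbit w j}))"
    by (metis card_Diff1_le card_Suc_Diff1 diff_Suc_1 Diff_empty Diff_insert0 finite_imageI
        finite_atLeastAtMost cycle_partition_def le_SucI order_refl)
  ultimately show ?thesis by linarith
qed

lemma cycles_id: "card (cycle_partition N id) = N"
proof -
  have "orbit id x = {x}" for x :: nat
    by (simp add: orbit_eq_singleton_iff)
  then show ?thesis by (simp add: cycle_partition_def card_image)
qed

section \<open>Words in reflections and reflection length\<close>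

lemma word_prod_W_A_simps [simp]:
  "word_prod (W_A n) [] = id"
  "word_prod (W_A n) (t # ws) = t \<circ> word_prod (W_A n) ws"
  by (simp_all add: word_prod_def W_A_def sym_group_mult sym_group_one)

lemma word_prod_W_A_append:
  "word_prod (W_A n) (us @ vs) = word_prod (W_A n) us \<circ> word_prod (W_A n) vs"
  by (induction us) auto

lemma reflection_permutes:
  "t \<in> reflections_A n \<Longrightarrow> t permutes {1..n+1}"
  by (auto simp: reflections_A_def intro!: permutes_swap_id)

lemma word_prod_permutes:
  assumes "set ws \<subseteq> reflections_A n"
  shows "word_prod (W_A n) ws permutes {1..n+1}"
  using assms
proof (induction ws)
  case (Cons t ws)
  then have "word_prod (W_A n) ws permutes {1..n+1}" "t permutes {1..n+1}"
    using reflection_permutes by auto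
  then show ?case unfolding word_prod_W_A_simps by (rule permutes_compose)
qed (simp add: permutes_id del: id_apply)

text \<open>The empty word has \<open>n + 1\<close> cycles, and each further letter lowers the
  number of cycles by at most one.\<close>

lemma word_length_ge:
  assumes "set ws \<subseteq> reflections_A n"
  shows "n + 1 \<le> card (cycle_partition (n+1) (word_prod (W_A n) ws)) + length ws"
  using assms
proof (induction ws)
  case Nil
  then show ?case by (simp add: cycles_id del: id_apply)
next
  case (Cons t ws)
  then obtain i j where "t = Transposition.transpose i j"
    by (auto simp: reflections_A_def)
  moreover have "permutation (word_prod (W_A n) ws)"
    using Cons.prems word_prod_permutes[of ws n] by (auto intro: permutes_permutation)
  ultimately have "card (cycle_partition (n+1) (word_prod (W_A n) ws))
      \<le> Suc (card (cycle_partition (n+1) (word_prod (W_A n) (t # ws))))"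
    using cycles_transpose_ge by (simp only: word_prod_W_A_simps)
  moreover have "n + 1 \<le> card (cycle_partition (n+1) (word_prod (W_A n) ws)) + length ws"
    using Cons by simp
  ultimately show ?case unfolding list.size by linarith
qed

text \<open>Cycles are cut down one point at a time: \<open>(x w(x)) \<circ> w\<close> fixes \<open>x\<close> and
  otherwise has the cycles of \<open>w\<close> with \<open>x\<close> removed.\<close>

lemma exists_short_word:
  assumes "w permutes {1..n+1}"
  shows "\<exists>ws. set ws \<subseteq> {Transposition.transpose i j | i j.
              1 \<le> i \<and> i < j \<and> j \<le> n + 1 \<and> orbit w i = orbit w j}
            \<and> word_prod (W_A n) ws = w
            \<and> length ws + card (cycle_partition (n+1) w) \<le> n + 1"
  using assms
proof (induction "card {x \<in> {1..n+1}. w x \<noteq> x}" arbitrary: w rule: less_induct)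
  case less
  note w = permutes_permutation[OF less.prems]
  show ?case
  proof (cases "\<exists>x. w x \<noteq> x")
    case False
    then have "w = id" by auto
    then show ?thesis
      by (intro exI[of _ "[]"]) (simp add: cycles_id del: id_apply)
  next
    case True
    then obtain x where x: "w x \<noteq> x" by blast
    have xN: "x \<in> {1..n+1}" "w x \<in> {1..n+1}"
      using x less.prems permutes_not_in permutes_in_image by metis+
    have inj: "w y = w z \<longleftrightarrow> y = z" for y z
      using permutes_inj[OF less.prems] by (auto dest: injD)
    define t where "t = Transposition.transpose x (w x)"
    define u where "u = t \<circ> w"
    have u_permutes: "u permutes {1..n+1}"
      unfolding u_def t_def using less.prems xN by (intro permutes_compose permutes_swap_id)
    have u_x: "u x = x" by (simp add: u_def t_def)
    have u_other: "u y = (if w y = x then w x else w y)" if "y \<noteq> x" for y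
      using that inj by (auto simp: u_def t_def Transposition.transpose_def)
    have u_orbit: "orbit w (u y) = orbit w y" for y
      by (cases "y = x") (use u_x u_other permutation_orbit_step[OF w] in metis)+
    have "{y \<in> {1..n+1}. u y \<noteq> y} \<subset> {y \<in> {1..n+1}. w y \<noteq> y}"
    proof
      show "{y \<in> {1..n+1}. u y \<noteq> y} \<subseteq> {y \<in> {1..n+1}. w y \<noteq> y}"
      proof clarify
        fix y assume "u y \<noteq> y" "w y = y"
        then show False using u_x u_other[of y] by (cases "y = x") auto
      qed
      show "{y \<in> {1..n+1}. u y \<noteq> y} \<noteq> {y \<in> {1..n+1}. w y \<noteq> y}"
        using x xN u_x by blast
    qed
    then have "card {y \<in> {1..n+1}. u y \<noteq> y} < card {y \<in> {1..n+1}. w y \<noteq> y}"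
      by (intro psubset_card_mono) auto
    from less.hyps[OF this u_permutes] obtain ws where
      ws: "set ws \<subseteq> {Transposition.transpose i j | i j.
              1 \<le> i \<and> i < j \<and> j \<le> n + 1 \<and> orbit u i = orbit u j}"
        "word_prod (W_A n) ws = u"
        "length ws + card (cycle_partition (n+1) u) \<le> n + 1"
      by blast
    have "orbit w i = orbit w j" if "orbit u i = orbit u j" for i j
      using that orbit_invariant[of "orbit w" u, OF u_orbit]
        permutation_self_in_orbit[OF permutes_permutation[OF u_permutes]] by metis
    with ws(1) have "set ws \<subseteq> {Transposition.transpose i j | i j.
              1 \<le> i \<and> i < j \<and> j \<le> n + 1 \<and> orbit w i = orbit w j}"
      by blast
    moreover have "t \<in> {Transposition.transpose i j | i j.
              1 \<le> i \<and> i < j \<and> j \<le> n + 1 \<and> orbit w i = orbit w j}"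
    proof (cases "x < w x")
      case True
      then show ?thesis using xN permutation_orbit_step[OF w, of x] unfolding t_def by force
    next
      case False
      then have "w x < x" using x by simp
      moreover have "t = Transposition.transpose (w x) x"
        by (simp add: t_def transpose_commute)
      ultimately show ?thesis using xN permutation_orbit_step[OF w, of x] by force
    qed
    moreover have "word_prod (W_A n) (t # ws) = w"
      by (simp add: ws u_def t_def flip: comp_assoc)
    moreover have "Suc (card (cycle_partition (n+1) w)) \<le> card (cycle_partition (n+1) u)"
    proof -
      \<comment> \<open>\<open>None\<close> singles out the new fixed point \<open>x\<close> of
        \<open>u\<close>. No cycle of \<open>w\<close> is lost among the \<open>Some\<close> values:
        that of \<open>x\<close> is still represented by \<open>w x\<close>, which differs from
        \<open>x\<close>.\<close>
      define f where "f y = (if y = x then None else Some (orbit w y))" for y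
      have "u y \<noteq> x" if "y \<noteq> x" for y
        using that u_x permutes_inj[OF u_permutes] by (metis injD)
      then have "f (u y) = f y" for y
        using u_x u_orbit by (auto simp: f_def)
      then have "card (f ` {1..n+1}) \<le> card (cycle_partition (n+1) u)"
        by (rule card_invariant_le_cycles)
      moreover have "insert None (Some ` cycle_partition (n+1) w) \<subseteq> f ` {1..n+1}"
      proof -
        have "None \<in> f ` {1..n+1}" using xN by (force simp: f_def)
        moreover have "Some (orbit w y) \<in> f ` {1..n+1}" if "y \<in> {1..n+1}" for y
        proof (cases "y = x")
          case True
          then have "Some (orbit w y) = f (w x)"
            using x by (simp add: f_def permutation_orbit_step[OF w])
          then show ?thesis using xN by blast
        next
          case False
          then have "Some (orbit w y) = f y" by (simp add: f_def)
          then show ?thesis using that by blast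
        qed
        ultimately show ?thesis by (auto simp: cycle_partition_def)
      qed
      then have "card (insert None (Some ` cycle_partition (n+1) w)) \<le> card (f ` {1..n+1})"
        by (intro card_mono) auto
      moreover have "card (insert None (Some ` cycle_partition (n+1) w))
          = Suc (card (cycle_partition (n+1) w))"
        by (subst card_insert_disjoint) (auto simp: cycle_partition_def card_image)
      ultimately show ?thesis by linarith
    qed
    ultimately show ?thesis
      using ws(3) by (intro exI[of _ "t # ws"]) auto
  qed
qed

text \<open>The word of \<open>exists_short_word\<close> attains the lower bound of
  \<open>word_length_ge\<close>. The equation is written as a sum to avoid subtraction on
  naturals.\<close>

lemma reflection_length_word:
  assumes "w permutes {1..n+1}"
  shows "reflection_length (W_A n) (reflections_A n) w + card (cycle_partition (n+1) w) = n + 1"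
    and "\<exists>ws. set ws \<subseteq> reflections_A n \<and> word_prod (W_A n) ws = w
           \<and> length ws = reflection_length (W_A n) (reflections_A n) w"
proof -
  obtain ws where ws: "set ws \<subseteq> reflections_A n" "word_prod (W_A n) ws = w"
      "length ws + card (cycle_partition (n+1) w) \<le> n + 1"
    using exists_short_word[OF assms] unfolding reflections_A_def by blast
  have "reflection_length (W_A n) (reflections_A n) w = length ws"
    unfolding reflection_length_def
  proof (rule Least_equality)
    fix k assume "\<exists>us. set us \<subseteq> reflections_A n \<and> length us = k \<and> word_prod (W_A n) us = w"
    then show "length ws \<le> k" using ws(3) word_length_ge by fastforce
  qed (use ws in blast)
  moreover from this show "\<exists>ws. set ws \<subseteq> reflections_A n \<and> word_prod (W_A n) ws = w
           \<and> length ws = reflection_length (W_A n) (reflections_A n) w"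
    using ws(1,2) by metis
  ultimately show "reflection_length (W_A n) (reflections_A n) w
      + card (cycle_partition (n+1) w) = n + 1"
    using ws(3) word_length_ge[OF ws(1)] unfolding ws(2) by linarith
qed

text \<open>This is the triangle inequality for reflection length, restated for numbers of cycles:
  shortest words of \<open>u\<close> and \<open>v\<close> concatenate to a word of the
  product.\<close>

lemma cycles_subadditive:
  assumes "u permutes {1..n+1}" "v permutes {1..n+1}"
  shows "card (cycle_partition (n+1) u) + card (cycle_partition (n+1) v)
    \<le> n + 1 + card (cycle_partition (n+1) (u \<circ> v))"
proof -
  obtain us vs where "set us \<subseteq> reflections_A n" "word_prod (W_A n) us = u"
      "length us = reflection_length (W_A n) (reflections_A n) u"
    "set vs \<subseteq> reflections_A n" "word_prod (W_A n) vs = v"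
      "length vs = reflection_length (W_A n) (reflections_A n) v"
    using reflection_length_word(2)[OF assms(1)] reflection_length_word(2)[OF assms(2)] by blast
  then show ?thesis
    using word_length_ge[of "us @ vs" n] reflection_length_word(1)[OF assms(1)]
      reflection_length_word(1)[OF assms(2)] by (simp add: word_prod_W_A_append)
qed

section \<open>The Coxeter element and the elements below it\<close>

lemma coxeter_elt_A_apply:
  "coxeter_elt_A n x = (if x \<in> {1..n} then x + 1 else if x = n + 1 then 1 else x)"
proof -
  \<comment> \<open>The induction is on the length \<open>k\<close> of a prefix of the word, with
    the ambient group fixed. The generator split off on the right acts first.\<close>
  have "word_prod (W_A n) (map simple_gen [1..<k + 1]) x
      = (if x \<in> {1..k} then x + 1 else if x = k + 1 then 1 else x)" for k
  proof (induction k arbitrary: x)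
    case (Suc k)
    have "word_prod (W_A n) (map simple_gen [1..<Suc k + 1])
        = word_prod (W_A n) (map simple_gen [1..<k + 1]) \<circ> simple_gen (Suc k)"
      by (simp add: word_prod_W_A_append)
    then have "word_prod (W_A n) (map simple_gen [1..<Suc k + 1]) x
        = word_prod (W_A n) (map simple_gen [1..<k + 1]) (simple_gen (Suc k) x)"
      by (simp only: comp_apply)
    also have "\<dots> = (if x \<in> {1..Suc k} then x + 1 else if x = Suc k + 1 then 1 else x)"
      unfolding Suc.IH by (auto simp: simple_gen_def Transposition.transpose_def)
    finally show ?case .
  qed auto
  then show ?thesis by (simp add: coxeter_elt_A_def)
qed

lemma coxeter_elt_A_permutes: "coxeter_elt_A n permutes {1..n+1}"
proof -
  have "set (map simple_gen [1..<n + 1]) \<subseteq> reflections_A n"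
    by (fastforce simp: reflections_A_def simple_gen_def)
  then show ?thesis
    unfolding coxeter_elt_A_def by (rule word_prod_permutes)
qed

lemma invariant_const:
  fixes f :: "nat \<Rightarrow> 'a"
  assumes "\<And>x. l \<le> x \<Longrightarrow> x < r \<Longrightarrow> f (Suc x) = f x" "l \<le> x" "x \<le> r"
  shows "f x = f l"
  using assms(2,3)
proof (induction x rule: dec_induct)
  case (step x)
  then show ?case using assms(1)[of x] by simp
qed simp

text \<open>The hypothesis is applied to \<open>f = orbit w\<close>, whence the set-valued
  \<open>f\<close>. In this form a single cycle is proved by chaining equations between values of an
  arbitrary invariant function.\<close>

lemma one_cycle:
  assumes "\<And>f :: nat \<Rightarrow> nat set. (\<And>x. f (w x) = f x) \<Longrightarrow> \<exists>c. \<forall>x\<in>{1..n+1}. f x = c"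
    and "permutation w"
  shows "card (cycle_partition (n+1) w) = 1"
proof -
  obtain c where "\<forall>x\<in>{1..n+1}. orbit w x = c"
    using assms(1)[of "orbit w", OF permutation_orbit_step[OF assms(2)]] by blast
  then have "cycle_partition (n+1) w = (\<lambda>_. c) ` {1..n+1}"
    unfolding cycle_partition_def by (intro image_cong) simp_all
  also have "\<dots> = {c}" by (simp add: image_constant_conv)
  finally have "cycle_partition (n+1) w = {c}" .
  then show ?thesis by simp
qed

lemma cycles_coxeter_elt_A: "card (cycle_partition (n+1) (coxeter_elt_A n)) = 1"
proof (rule one_cycle)
  show "permutation (coxeter_elt_A n)"
    using coxeter_elt_A_permutes by (rule permutes_permutation)
  fix f :: "nat \<Rightarrow> nat set" assume f: "\<And>x. f (coxeter_elt_A n x) = f x"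
  have "f (Suc x) = f x" if "1 \<le> x" "x < n + 1" for x
    using f[of x] that by (simp add: coxeter_elt_A_apply)
  then show "\<exists>c. \<forall>x\<in>{1..n+1}. f x = c"
    using invariant_const[of 1 "n+1" f] by (metis atLeastAtMost_iff)
qed

text \<open>Each reflection length is \<open>n + 1\<close> minus a number of cycles, and the Coxeter
  element has one cycle, so additivity of lengths turns into this equation.\<close>

lemma NC_A_iff:
  "w \<in> NC_A n \<longleftrightarrow> w permutes {1..n+1} \<and>
     card (cycle_partition (n+1) w) + card (cycle_partition (n+1) (inv' w \<circ> coxeter_elt_A n)) = n + 2"
proof (cases "w permutes {1..n+1}")
  case True
  let ?c = "coxeter_elt_A n" let ?l = "reflection_length (W_A n) (reflections_A n)"
  have wc: "inv' w \<circ> ?c permutes {1..n+1}"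
    using True coxeter_elt_A_permutes by (intro permutes_compose permutes_inv)
  have carrier: "w \<in> carrier (sym_group (n+1))" "id \<in> carrier (sym_group (n+1))"
    unfolding sym_group_carrier using True permutes_id by auto
  then have inv: "inv\<^bsub>W_A n\<^esub> w = inv' w" "inv\<^bsub>W_A n\<^esub> id = id"
    unfolding W_A_def by (simp_all add: inv_id del: id_apply)
  have "?l id = 0"
    using reflection_length_word(1)[of id n] by (simp add: cycles_id permutes_id del: id_apply)
  then have "absolute_le (W_A n) (reflections_A n) \<one>\<^bsub>W_A n\<^esub> w"
    using inv(2) by (simp add: absolute_le_def W_A_def sym_group_one sym_group_mult)
  moreover have "absolute_le (W_A n) (reflections_A n) w ?c \<longleftrightarrow>
      ?l ?c = ?l w + ?l (inv' w \<circ> ?c)"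
    using inv(1) by (simp add: absolute_le_def W_A_def sym_group_mult)
  ultimately show ?thesis
    using True carrier reflection_length_word(1)[OF True] reflection_length_word(1)[OF wc]
      reflection_length_word(1)[OF coxeter_elt_A_permutes[of n]] cycles_coxeter_elt_A[of n]
    by (auto simp: NC_A_def W_A_def)
qed (simp add: NC_A_def W_A_def sym_group_carrier)

section \<open>The cycle partitions of the elements below the Coxeter element are the noncrossing
  partitions\<close>

text \<open>Walk along the cycle from \<open>a\<close> until just before the first visit to
  \<open>c\<close>. The transposition redirects the step into \<open>c\<close> back to
  \<open>a\<close>, so the points walked form a stable set \<open>A\<close> that separates
  \<open>a\<close> from \<open>c\<close>.\<close>

lemma transpose_orbit_split:
  assumes "permutation w" "c \<in> orbit w a" "a \<noteq> c"
  obtains A where "finite A" "A \<subseteq> orbit w a" "a \<in> A" "c \<notin> A"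
    "(Transposition.transpose a c \<circ> w) ` A \<subseteq> A"
proof -
  define k where "k = (LEAST k. (w ^^ k) a = c)"
  have "\<exists>k. (w ^^ k) a = c"
    using assms(2) by (auto simp: orbit_altdef)
  then have k: "(w ^^ k) a = c"
    unfolding k_def by (rule LeastI_ex)
  have least: "(w ^^ i) a \<noteq> c" if "i < k" for i
    using that not_less_Least unfolding k_def by blast
  define A where "A = (\<lambda>i. (w ^^ i) a) ` {..<k}"
  have "0 < k" using k assms(3) by (cases k) auto
  then have "a \<in> A" by (force simp: A_def)
  have "(Transposition.transpose a c \<circ> w) ((w ^^ i) a) \<in> A" if "i < k" for i
  proof (cases "Suc i = k")
    case True
    then have "w ((w ^^ i) a) = c" using k by auto
    with \<open>a \<in> A\<close> show ?thesis by simp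
  next
    case False
    then have i: "Suc i < k" using that by simp
    then have "(w ^^ Suc i) a \<noteq> c" by (rule least)
    \<comment> \<open>A return to \<open>a\<close> after \<open>Suc i\<close> steps would leave only
      \<open>k - Suc i\<close> steps to \<open>c\<close>, against the minimality of
      \<open>k\<close>.\<close>
    moreover have "(w ^^ Suc i) a \<noteq> a"
    proof
      assume "(w ^^ Suc i) a = a"
      then have "(w ^^ (k - Suc i)) a = (w ^^ (k - Suc i + Suc i)) a"
        by (simp only: funpow_add comp_apply)
      also have "\<dots> = c" using i k by simp
      finally show False using least[of "k - Suc i"] i by simp
    qed
    ultimately have "(Transposition.transpose a c \<circ> w) ((w ^^ i) a) = (w ^^ Suc i) a"
      by simp
    moreover have "(w ^^ Suc i) a \<in> A" unfolding A_def using i by blast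
    ultimately show ?thesis by simp
  qed
  then have "(Transposition.transpose a c \<circ> w) ` A \<subseteq> A"
    by (auto simp: A_def)
  moreover have "A \<subseteq> orbit w a"
    using funpow_in_orbit[OF permutation_self_in_orbit[OF assms(1)]] by (auto simp: A_def)
  ultimately show thesis
    using \<open>a \<in> A\<close> least by (intro that[of A]) (auto simp: A_def)
qed

text \<open>The two transpositions act inside two different cycles of \<open>w\<close>, so neither
  disturbs the splitting done by the other, and each contributes a new cycle.\<close>

lemma crossing_cycles_split:
  assumes w: "w permutes {1..N}" and N: "a \<in> {1..N}" "b \<in> {1..N}"  "c \<in> {1..N}" "d \<in> {1..N}"
    and c: "c \<in> orbit w a" "a \<noteq> c" and d: "d \<in> orbit w b" "b \<noteq> d"
    and ab: "orbit w a \<noteq> orbit w b"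
  shows "card (cycle_partition N w) + 2 \<le> card (cycle_partition N
     (Transposition.transpose b d \<circ> Transposition.transpose a c \<circ> w))"
proof -
  note perm = permutes_permutation[OF w]
  let ?tac = "Transposition.transpose a c" and ?tbd = "Transposition.transpose b d"
  define u where "u = ?tbd \<circ> ?tac \<circ> w"
  obtain A where A: "finite A" "A \<subseteq> orbit w a" "a \<in> A" "c \<notin> A" "(?tac \<circ> w) ` A \<subseteq> A"
    using transpose_orbit_split[OF perm c] by blast
  obtain B where B: "finite B" "B \<subseteq> orbit w b" "b \<in> B" "d \<notin> B" "(?tbd \<circ> w) ` B \<subseteq> B"
    using transpose_orbit_split[OF perm d] by blast
  have orbits: "orbit w c = orbit w a" "orbit w d = orbit w b"
    using c d by (simp_all add: orbit_eq_iff[OF perm])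
  have in_A: "orbit w x = orbit w a" if "x \<in> A" for x
    using that A(2) orbit_eq_iff[OF perm] by blast
  have in_B: "orbit w x = orbit w b" if "x \<in> B" for x
    using that B(2) orbit_eq_iff[OF perm] by blast
  have "inj u"
    unfolding u_def using permutes_inj[OF w] by (intro inj_compose) auto
  have step: "orbit w (w x) = orbit w x" for x
    by (rule permutation_orbit_step[OF perm])
  have u_orbit: "orbit w (u x) = orbit w x" for x
  proof -
    have "orbit w (?tac y) = orbit w y" "orbit w (?tbd y) = orbit w y" for y
      using orbits by (auto simp: Transposition.transpose_def)
    then show ?thesis using step by (simp add: u_def)
  qed
  have "u x = ?tac (w x)" if "x \<in> A" for x
  proof -
    have "?tac (w x) \<in> A" using that A(5) by auto
    then have "?tac (w x) \<noteq> b" "?tac (w x) \<noteq> d" using in_A ab orbits by metis+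
    then show ?thesis by (simp add: u_def)
  qed
  then have "u ` A \<subseteq> A" using A(5) by auto
  then have u_A: "u x \<in> A \<longleftrightarrow> x \<in> A" for x
    using \<open>inj u\<close> A(1) by (intro stable_set_iff)
  have "u x = ?tbd (w x)" if "x \<in> B" for x
  proof -
    have "orbit w (w x) = orbit w b" using that in_B step by simp
    then have "w x \<noteq> a" "w x \<noteq> c" using ab orbits by metis+
    then show ?thesis by (simp add: u_def)
  qed
  then have "u ` B \<subseteq> B" using B(5) by auto
  then have u_B: "u x \<in> B \<longleftrightarrow> x \<in> B" for x
    using \<open>inj u\<close> B(1) by (intro stable_set_iff)
  \<comment> \<open>The old cycle, refined by membership in the two split-off parts, is invariant
    under \<open>u\<close>.\<close>
  define f where "f x = (orbit w x, x \<in> A, x \<in> B)" for x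
  have "card (f ` {1..N}) \<le> card (cycle_partition N u)"
    using u_orbit u_A u_B by (intro card_invariant_le_cycles) (simp add: f_def)
  moreover have "card (cycle_partition N w) + 2 \<le> card (f ` {1..N})"
  proof -
    have a_B: "a \<notin> B" "c \<notin> B" and b_A: "b \<notin> A" "d \<notin> A"
      using in_A in_B ab orbits by metis+
    \<comment> \<open>Every cycle of \<open>w\<close> occurs with both flags false, since
      \<open>c\<close> and \<open>d\<close> lie outside \<open>A\<close> and \<open>B\<close>. The
      values at \<open>a\<close> and \<open>b\<close> carry a true flag and are the two additional
      ones.\<close>
    define G where "G = (\<lambda>C. (C, False, False)) ` cycle_partition N w"
    have "(orbit w x, False, False) \<in> f ` {1..N}" if "x \<in> {1..N}" for x
    proof -
      consider "orbit w x = orbit w a" | "orbit w x = orbit w b"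
        | "orbit w x \<noteq> orbit w a" "orbit w x \<noteq> orbit w b" by blast
      then show ?thesis
      proof cases
        case 1
        then have "(orbit w x, False, False) = f c" using orbits A(4) a_B by (simp add: f_def)
        then show ?thesis using N by blast
      next
        case 2
        then have "(orbit w x, False, False) = f d" using orbits B(4) b_A by (simp add: f_def)
        then show ?thesis using N by blast
      next
        case 3
        then have "(orbit w x, False, False) = f x" using in_A in_B by (auto simp: f_def)
        then show ?thesis using that by blast
      qed
    qed
    then have "G \<subseteq> f ` {1..N}" by (auto simp: G_def cycle_partition_def)
    moreover have "{f a, f b} \<subseteq> f ` {1..N}" using N by blast
    ultimately have "card (G \<union> {f a, f b}) \<le> card (f ` {1..N})"
      by (intro card_mono) auto
    moreover have "card (G \<union> {f a, f b}) = card G + card {f a, f b}"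
      using A(3) B(3) by (intro card_Un_disjoint) (auto simp: G_def f_def cycle_partition_def)
    moreover have "card {f a, f b} = 2"
      using ab by (simp add: f_def)
    moreover have "card G = card (cycle_partition N w)"
      unfolding G_def by (intro card_image inj_onI) simp
    ultimately show ?thesis by linarith
  qed
  ultimately show ?thesis by (simp add: u_def comp_assoc)
qed

text \<open>Cut the cycle of the Coxeter element in front of \<open>a\<close>, \<open>b\<close>,
  \<open>c\<close> and \<open>d\<close>. Inside the four arcs the product still acts as the
  successor, while the ends are rejoined by sending \<open>b - 1\<close> to \<open>d\<close>,
  \<open>c - 1\<close> to \<open>a\<close>, \<open>d - 1\<close> to \<open>b\<close> and the point
  before \<open>a\<close> to \<open>c\<close>. This links the arcs into one cycle.\<close>

lemma cycles_crossing_coxeter_elt_A: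
  assumes "1 \<le> a" "a < b" "b < c" "c < d" "d \<le> n + 1"
  shows "card (cycle_partition (n+1)
    (Transposition.transpose b d \<circ> Transposition.transpose a c \<circ> coxeter_elt_A n)) = 1"
    (is "card (cycle_partition _ ?v) = 1")
proof (rule one_cycle)
  have "?v permutes {1..n+1}"
    using assms coxeter_elt_A_permutes by (intro permutes_compose permutes_swap_id) auto
  then show "permutation ?v" by (rule permutes_permutation)
  fix f :: "nat \<Rightarrow> nat set" assume inv: "\<And>x. f (?v x) = f x"
  then have f: "f (Transposition.transpose b d (Transposition.transpose a c (Suc x))) = f x"
    if "1 \<le> x" "x \<le> n" for x
    using inv[of x] that by (simp add: coxeter_elt_A_apply)
  have f1: "f (Transposition.transpose b d (Transposition.transpose a c 1)) = f (n + 1)"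
    using inv[of "n + 1"] by (simp add: coxeter_elt_A_apply)
  have other: "f (Suc x) = f x" if "1 \<le> x" "x \<le> n" "Suc x \<notin> {a, b, c, d}" for x
    using f[of x] that by (simp add: Transposition.transpose_def)
  have b: "f d = f (b - 1)" using f[of "b - 1"] assms by (simp add: Transposition.transpose_def)
  have c: "f a = f (c - 1)" using f[of "c - 1"] assms by (simp add: Transposition.transpose_def)
  have d: "f b = f (d - 1)" using f[of "d - 1"] assms by (simp add: Transposition.transpose_def)
  have seg_ab: "f x = f a" if "a \<le> x" "x \<le> b - 1" for x
    using that assms by (intro invariant_const[of a "b - 1"] other) auto
  have seg_bc: "f x = f b" if "b \<le> x" "x \<le> c - 1" for x
    using that assms by (intro invariant_const[of b "c - 1"] other) auto
  have seg_cd: "f x = f c" if "c \<le> x" "x \<le> d - 1" for x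
    using that assms by (intro invariant_const[of c "d - 1"] other) auto
  have seg_d: "f x = f d" if "d \<le> x" "x \<le> n + 1" for x
    using that assms by (intro invariant_const[of d "n + 1"] other) auto
  have seg_1: "f x = f 1" if "1 \<le> x" "x \<le> a - 1" for x
    using that assms by (intro invariant_const[of 1 "a - 1"] other) auto
  have eqs: "f d = f a" "f a = f b" "f b = f c"
    using b c d seg_ab[of "b - 1"] seg_bc[of "c - 1"] seg_cd[of "d - 1"] assms by auto
  \<comment> \<open>If \<open>a\<close> is not 1, the arc that starts at \<open>d\<close> runs
    through \<open>n + 1\<close> and continues at 1; if \<open>a\<close> is 1, that arc ends at
    \<open>n + 1\<close>.\<close>
  have "f 1 = f a"
  proof (cases "a = 1")
    case False
    then have "f 1 = f (n + 1)" using f1 assms by (simp add: Transposition.transpose_def)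
    then show ?thesis using seg_d[of "n + 1"] eqs assms by simp
  qed simp
  have "f x = f a" if "x \<in> {1..n+1}" for x
  proof -
    consider "x < a" | "a \<le> x" "x < b" | "b \<le> x" "x < c" | "c \<le> x" "x < d" | "d \<le> x"
      by linarith
    then show ?thesis
    proof cases
      case 1
      then show ?thesis using seg_1[of x] \<open>f 1 = f a\<close> that by simp
    next
      case 2
      then show ?thesis using seg_ab[of x] by simp
    next
      case 3
      then show ?thesis using seg_bc[of x] eqs by simp
    next
      case 4
      then show ?thesis using seg_cd[of x] eqs by simp
    next
      case 5
      then show ?thesis using seg_d[of x] eqs that by simp
    qed
  qed
  then show "\<exists>x. \<forall>y\<in>{1..n+1}. f y = x" by blast
qed

lemma cycle_partition_partition_on:
  assumes "w permutes {1..N}"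
  shows "partition_on {1..N} (cycle_partition N w)"
proof (rule partition_onI)
  note perm = permutes_permutation[OF assms]
  show "\<Union> (cycle_partition N w) = {1..N}"
    using permutes_orbit_subset[OF assms] permutation_self_in_orbit[OF perm]
    unfolding cycle_partition_def by blast
  show "{} \<notin> cycle_partition N w"
    using orbit_nonempty[of w] unfolding cycle_partition_def by force
  show "disjnt p q" if pq: "p \<in> cycle_partition N w" "q \<in> cycle_partition N w" "p \<noteq> q" for p q
  proof -
    obtain x y where "p = orbit w x" "q = orbit w y" using pq by (auto simp: cycle_partition_def)
    with pq(3) show ?thesis
      unfolding disjnt_iff using orbit_eq_iff[OF perm] by metis
  qed
qed

text \<open>For crossing cycles, multiplication by \<open>(a c)\<close> and \<open>(b d)\<close> shortens \<open>w\<close> by 2, whereas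
  it turns the Coxeter element into another full cycle.\<close>

lemma cycle_partition_NC:
  assumes "w \<in> NC_A n"
  shows "cycle_partition (n+1) w \<in> NC (n+1)"
proof -
  have w: "w permutes {1..n+1}"
    and cycles: "card (cycle_partition (n+1) w)
      + card (cycle_partition (n+1) (inv' w \<circ> coxeter_elt_A n)) = n + 2"
    using assms by (simp_all add: NC_A_iff)
  note perm = permutes_permutation[OF w]
  have "C = C'" if C: "C \<in> cycle_partition (n+1) w" "C' \<in> cycle_partition (n+1) w"
    and abcd: "a < b" "b < c" "c < d" "a \<in> C" "c \<in> C" "b \<in> C'" "d \<in> C'" for a b c d C C'
  proof (rule ccontr)
    assume "C \<noteq> C'"
    have orbits: "C = orbit w x" if "x \<in> C" "C \<in> cycle_partition (n+1) w" for x C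
      using that orbit_eq_iff[OF perm] by (auto simp: cycle_partition_def)
    have range: "x \<in> {1..n+1}" if "x \<in> C \<union> C'" for x
      using C that cycle_partition_partition_on[OF w] unfolding partition_on_def by blast
    let ?t = "Transposition.transpose b d \<circ> Transposition.transpose a c"
    have in_range: "a \<in> {1..n+1}" "b \<in> {1..n+1}" "c \<in> {1..n+1}" "d \<in> {1..n+1}"
      using range abcd by blast+
    have "card (cycle_partition (n+1) w) + 2 \<le> card (cycle_partition (n+1) (?t \<circ> w))"
      using orbits C abcd \<open>C \<noteq> C'\<close> by (intro crossing_cycles_split w in_range) auto
    \<comment> \<open>With \<open>cycles\<close>, the left side is at least \<open>n + 4\<close>.
      The product on the right is a full cycle, so the right side is \<open>n + 2\<close>.\<close>
    moreover have "card (cycle_partition (n+1) (?t \<circ> w))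
        + card (cycle_partition (n+1) (inv' w \<circ> coxeter_elt_A n))
      \<le> n + 1 + card (cycle_partition (n+1) ((?t \<circ> w) \<circ> (inv' w \<circ> coxeter_elt_A n)))"
      using w coxeter_elt_A_permutes in_range
      by (intro cycles_subadditive permutes_compose permutes_inv permutes_swap_id)
    moreover have "(?t \<circ> w) \<circ> (inv' w \<circ> coxeter_elt_A n) = ?t \<circ> coxeter_elt_A n"
      using permutes_inverses(1)[OF w] by (simp add: fun_eq_iff)
    moreover have "card (cycle_partition (n+1) (?t \<circ> coxeter_elt_A n)) = 1"
      using in_range abcd by (intro cycles_crossing_coxeter_elt_A) auto
    ultimately show False using cycles by simp
  qed
  then show ?thesis
    unfolding NC_def noncrossing_def using cycle_partition_partition_on[OF w] by blast
qed

text \<open>The permutation \<open>g\<close> below, the inverse of the wanted element, moves every point to its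
  predecessor in its block. For each of the \<open>n + 1 - card P\<close> points \<open>y\<close> that are not minimal in
  their block, the interval from \<open>g y\<close> to \<open>y - 1\<close> is stable under \<open>g \<circ> c\<close>, which
  provides the cycles that \<open>g \<circ> c\<close> must have.\<close>

lemma NC_is_cycle_partition:
  assumes "P \<in> NC (n+1)"
  shows "\<exists>w \<in> NC_A n. cycle_partition (n+1) w = P"
proof -
  let ?N = "{1..n+1}" and ?c = "coxeter_elt_A n"
  have part: "partition_on ?N P" and nc: "noncrossing P"
    using assms by (auto simp: NC_def)
  have union: "\<Union>P = ?N" using part by (simp add: partition_on_def)
  then have "\<forall>x\<in>?N. \<exists>B. B \<in> P \<and> x \<in> B" by blast
  from bchoice[OF this] obtain blk where blk: "blk x \<in> P" "x \<in> blk x" if "x \<in> ?N" for x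
    by blast
  have uniq: "B = blk x" if "B \<in> P" "x \<in> B" for B x
    using that part blk[of x] union unfolding partition_on_def disjoint_def by blast
  have blk_sub: "blk x \<subseteq> ?N" if "x \<in> ?N" for x
    using that blk union by blast
  have blk_fin: "finite (blk x)" if "x \<in> ?N" for x
    using blk_sub[OF that] finite_subset by blast
  have blk_eq: "blk y = blk x" if "x \<in> ?N" "y \<in> blk x" for x y
    using uniq that blk by metis
  define g where "g y = (if y \<notin> ?N then y else if y = Min (blk y) then Max (blk y)
      else Max {z \<in> blk y. z < y})" for y
  define D where "D = {y \<in> ?N. y \<noteq> Min (blk y)}"
  have Min_in: "Min (blk y) \<in> blk y" "Min (blk y) \<le> y" if "y \<in> ?N" for y
    using blk_fin[OF that] blk(2)[OF that] by (auto intro: Min_in)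
  have g_D: "g y \<in> blk y" "g y < y" and g_D_max: "\<And>z. z \<in> blk y \<Longrightarrow> z < y \<Longrightarrow> z \<le> g y"
    if "y \<in> D" for y
  proof -
    have y: "y \<in> ?N" "y \<noteq> Min (blk y)" using that by (auto simp: D_def)
    then have "Min (blk y) \<in> {z \<in> blk y. z < y}" using Min_in[of y] by auto
    moreover have fin: "finite {z \<in> blk y. z < y}" using blk_fin y by simp
    ultimately have "Max {z \<in> blk y. z < y} \<in> {z \<in> blk y. z < y}"
      by (intro Max_in) auto
    then show "g y \<in> blk y" "g y < y" using y by (auto simp: g_def)
    show "z \<le> g y" if "z \<in> blk y" "z < y" for z
      using that y Max_ge[OF fin] by (simp add: g_def)
  qed
  have g_Min: "g y \<in> blk y" "\<And>z. z \<in> blk y \<Longrightarrow> z \<le> g y" if "y \<in> ?N" "y \<notin> D" for y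
  proof -
    have "g y = Max (blk y)" using that by (simp add: D_def g_def)
    then show "g y \<in> blk y" "\<And>z. z \<in> blk y \<Longrightarrow> z \<le> g y"
      using that blk_fin[of y] blk(2)[of y] by (auto intro: Max_in)
  qed
  have g_blk: "g y \<in> blk y" if "y \<in> ?N" for y
    using that g_D g_Min by blast
  \<comment> \<open>For \<open>y < z\<close> in one block, \<open>g z\<close> lies between
    \<open>y\<close> and \<open>z - 1\<close>, whereas \<open>g y\<close> is either below
    \<open>y\<close> or at least \<open>z\<close>.\<close>
  have g_neq: "g y \<noteq> g z" if "y \<in> ?N" "z \<in> ?N" "y < z" for y z
  proof
    assume eq: "g y = g z"
    then have "blk y = blk z" using that g_blk blk_eq by metis
    then have yz: "y \<in> blk z" "z \<in> blk y" using blk that by auto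
    have "Min (blk z) \<le> y" using yz that blk_fin by simp
    then have "z \<in> D" using that by (auto simp: D_def)
    then have "y \<le> g z" "g z < z" using g_D g_D_max yz that by auto
    moreover have "g y < y \<or> z \<le> g y" using g_D(2) g_Min(2) yz that by blast
    ultimately show False using eq by simp
  qed
  have "inj_on g ?N"
    by (rule linorder_inj_onI) (use g_neq in auto)
  moreover have "g ` ?N \<subseteq> ?N" using g_blk blk_sub by blast
  ultimately have "bij_betw g ?N ?N"
    by (simp add: bij_betw_def endo_inj_surj)
  then have g: "g permutes ?N"
    by (rule bij_imp_permutes) (simp add: g_def)
  note perm = permutes_permutation[OF g]
  \<comment> \<open>Iterating \<open>g\<close> descends through the block until the minimum is
    reached, so points of one block share an orbit.\<close>
  have orbit_Min: "Min (blk y) \<in> orbit g y" if "y \<in> ?N" for y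
    using that
  proof (induction y rule: less_induct)
    case (less y)
    show ?case
    proof (cases "y \<in> D")
      case True
      then have "Min (blk (g y)) \<in> orbit g (g y)"
        using less g_D blk_sub by blast
      moreover have "blk (g y) = blk y" using less.prems g_blk blk_eq by blast
      ultimately show ?thesis by (auto intro: orbit_subset)
    next
      case False
      then have "Min (blk y) = y" using less.prems by (simp add: D_def)
      then show ?thesis using permutation_self_in_orbit[OF perm] by simp
    qed
  qed
  have orbit_g: "orbit g y = blk y" if "y \<in> ?N" for y
  proof
    show "orbit g y \<subseteq> blk y"
    proof
      fix z assume "z \<in> orbit g y"
      then show "z \<in> blk y"
      proof induction
        case base
        then show ?case using g_blk that by blast
      next
        case (step z)
        then show ?case using g_blk[of z] blk_eq[of y z] blk_sub that by blast
      qed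
    qed
    show "blk y \<subseteq> orbit g y"
    proof
      fix z assume z: "z \<in> blk y"
      then have "z \<in> ?N" "blk z = blk y" using that blk_sub blk_eq by blast+
      then have "orbit g z = orbit g y"
        using orbit_Min[of z] orbit_Min[OF that] orbit_eq_iff[OF perm] by metis
      then show "z \<in> orbit g y" using permutation_self_in_orbit[OF perm] by metis
    qed
  qed
  have "cycle_partition (n+1) g = blk ` ?N"
    unfolding cycle_partition_def using orbit_g by (intro image_cong) auto
  also have "\<dots> = P"
  proof
    show "P \<subseteq> blk ` ?N"
    proof
      fix B assume B: "B \<in> P"
      then obtain x where "x \<in> B" using part by (metis partition_onD3 ex_in_conv)
      then show "B \<in> blk ` ?N" using B uniq union by blast
    qed
  qed (use blk in blast)
  finally have P_g: "cycle_partition (n+1) g = P" .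
  define w where "w = inv' g"
  have w: "w permutes ?N" unfolding w_def using g by (rule permutes_inv)
  have inv_w: "inv' w = g" unfolding w_def using g by (rule permutes_inv_inv)
  have P_w: "cycle_partition (n+1) w = P"
    using P_g by (simp add: w_def cycle_partition_def orbit_inv_eq[OF perm])
  define v where "v = g \<circ> ?c"
  have v: "v permutes ?N"
    unfolding v_def using coxeter_elt_A_permutes g by (rule permutes_compose)
  define I where "I y = {g y..y - 1}" for y
  have "v ` I y \<subseteq> I y" if y: "y \<in> D" for y
  proof -
    have yN: "y \<in> ?N" using y by (simp add: D_def)
    have gyN: "g y \<in> ?N" using g_blk blk_sub yN by blast
    have "v x \<in> I y" if x: "g y \<le> x" "x \<le> y - 1" for x
    proof -
      have "x \<in> {1..n}" using x yN gyN by auto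
      then have vx: "v x = g (x + 1)" by (simp add: v_def coxeter_elt_A_apply)
      show ?thesis
      proof (cases "x + 1 = y")
        case True
        then show ?thesis using vx g_D[OF y] by (simp add: I_def)
      next
        case False
        define z where "z = x + 1"
        have z: "g y < z" "z < y" using x False yN by (auto simp: z_def)
        then have zN: "z \<in> ?N" using gyN yN by auto
        have "z \<notin> blk y" using g_D_max[OF y] z by fastforce
        then have neq: "blk z \<noteq> blk y" using blk(2) zN by blast
        \<comment> \<open>This is where noncrossing enters: \<open>g y\<close> and \<open>y\<close>
          enclose \<open>z\<close>, so \<open>g z\<close>, in the same block as \<open>z\<close> but
          not in that of \<open>y\<close>, cannot lie outside them.\<close>
        have "g y < g z \<and> g z < y"
        proof (rule ccontr)
          assume outside: "\<not> (g y < g z \<and> g z < y)"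
          have in_z: "z \<in> blk z" "g z \<in> blk z" and in_y: "y \<in> blk y" "g y \<in> blk y"
            using g_blk blk zN yN by auto
          have "g z \<noteq> g y" "g z \<noteq> y"
            using neq in_z in_y blk_eq zN yN by metis+
          with outside consider "g z < g y" | "y < g z" by linarith
          then show False
          proof cases
            case 1
            then show False
              using nc z in_z in_y neq blk(1)[OF zN] blk(1)[OF yN]
              unfolding noncrossing_def by blast
          next
            case 2
            then show False
              using nc z in_z in_y neq blk(1)[OF zN] blk(1)[OF yN]
              unfolding noncrossing_def by blast
          qed
        qed
        then show ?thesis using vx by (auto simp: I_def z_def)
      qed
    qed
    then show ?thesis by (auto simp: I_def)
  qed
  then have stable: "v x \<in> I y \<longleftrightarrow> x \<in> I y" if "y \<in> D" for x y
    using that permutes_inj[OF v] by (intro stable_set_iff) (auto simp: I_def)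
  define f where "f x = {y \<in> D. x \<in> I y}" for x
  have "card (f ` ?N) \<le> card (cycle_partition (n+1) v)"
    using stable by (intro card_invariant_le_cycles) (auto simp: f_def)
  moreover have "card D + 1 \<le> card (f ` ?N)"
  proof -
    have D_bounds: "2 \<le> y" "y \<le> n + 1" if "y \<in> D" for y
      using that g_D[OF that] blk_sub[of y] by (auto simp: D_def)
    \<comment> \<open>The right ends \<open>y - 1\<close> of the intervals, together with
      \<open>n + 1\<close>, already take pairwise different values: for \<open>x < x'\<close> in
      \<open>E\<close>, the point \<open>x\<close> is the right end of some \<open>I y\<close>,
      which contains \<open>x\<close> but not \<open>x'\<close>. The extra point
      \<open>n + 1\<close> yields the summand 1.\<close>
    define E where "E = insert (n + 1) ((\<lambda>y. y - 1) ` D)"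
    have "f x \<noteq> f x'" if xx': "x \<in> E" "x' \<in> E" "x < x'" for x x'
    proof -
      have "x \<noteq> n + 1"
        using xx' D_bounds by (fastforce simp: E_def)
      then obtain y where y: "y \<in> D" "x = y - 1"
        using xx'(1) by (auto simp: E_def)
      then have "y \<in> f x" using g_D[of y] by (auto simp: f_def I_def)
      moreover have "y \<notin> f x'" using y xx'(3) by (auto simp: f_def I_def)
      ultimately show ?thesis by blast
    qed
    then have "inj_on f E"
      by (intro linorder_inj_onI) auto
    moreover have "inj_on (\<lambda>y. y - 1) D"
    proof (rule inj_onI)
      fix y z assume "y \<in> D" "z \<in> D" "y - 1 = z - 1"
      then show "y = z" using D_bounds(1)[of y] D_bounds(1)[of z] by linarith
    qed
    moreover have "finite D" by (simp add: D_def)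
    moreover have "n + 1 \<notin> (\<lambda>y. y - 1) ` D"
      using D_bounds by fastforce
    ultimately have "card (f ` E) = card D + 1"
      by (simp add: card_image E_def)
    moreover have "E \<subseteq> ?N" using D_bounds by (fastforce simp: E_def)
    then have "card (f ` E) \<le> card (f ` ?N)"
      by (intro card_mono image_mono) auto
    ultimately show ?thesis by simp
  qed
  moreover have "n + 1 \<le> card D + card P"
  proof -
    have finP: "finite P" using part finite_elements by blast
    have "?N \<subseteq> D \<union> Min ` P" using blk by (auto simp: D_def image_iff)
    then have "card ?N \<le> card (D \<union> Min ` P)"
      using finP by (intro card_mono) (auto simp: D_def)
    also have "\<dots> \<le> card D + card P"
      using card_Un_le[of D "Min ` P"] card_image_le[OF finP, of Min] by linarith
    finally show ?thesis by simp
  qed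
  ultimately have "n + 2 \<le> card (cycle_partition (n+1) w) + card (cycle_partition (n+1) v)"
    unfolding P_w by linarith
  \<comment> \<open>Subadditivity supplies the opposite inequality, because
    \<open>w \<circ> v\<close> is the Coxeter element and has a single cycle.\<close>
  moreover have "card (cycle_partition (n+1) w) + card (cycle_partition (n+1) v)
      \<le> n + 1 + card (cycle_partition (n+1) (w \<circ> v))"
    using w v by (rule cycles_subadditive)
  moreover have "w \<circ> v = ?c"
    using permutes_inverses(2)[OF g] by (simp add: w_def v_def fun_eq_iff)
  ultimately have "w \<in> NC_A n"
    using w inv_w cycles_coxeter_elt_A[of n] by (simp add: NC_A_iff v_def del: o_apply)
  with P_w show ?thesis by blast
qed

section \<open>Standard parabolic subgroups and positivity\<close>

lemma simple_gen_eq_iff: "simple_gen i = simple_gen k \<longleftrightarrow> i = k"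
proof
  assume "simple_gen i = simple_gen k"
  then have "simple_gen i i = simple_gen k i" by simp
  then show "i = k" by (auto simp: simple_gen_def Transposition.transpose_def split: if_splits)
qed simp

text \<open>A proper subset omits some \<open>simple_gen k\<close>. Every other simple generator
  exchanges two points on the same side of the gap between \<open>k\<close> and
  \<open>k + 1\<close>, and this property passes to the generated subgroup.\<close>

lemma generate_stabilises:
  assumes "J \<subset> simple_gens_A n"
  obtains k where "k \<in> {1..n}"
    "\<And>h x. h \<in> generate (W_A n) J \<Longrightarrow> h x \<le> k \<longleftrightarrow> x \<le> k"
proof -
  obtain k where k: "k \<in> {1..n}" "simple_gen k \<notin> J"
    using assms unfolding simple_gens_A_def by blast
  have gen: "inv\<^bsub>W_A n\<^esub> h = h" "h x \<le> k \<longleftrightarrow> x \<le> k" if h: "h \<in> J" for h x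
  proof -
    obtain i where i: "i \<in> {1..n}" "h = simple_gen i" "i \<noteq> k"
      using h k assms unfolding simple_gens_A_def by blast
    then have "h \<in> carrier (sym_group (n+1))"
      unfolding sym_group_carrier simple_gen_def by (auto intro!: permutes_swap_id)
    then show "inv\<^bsub>W_A n\<^esub> h = h" by (simp add: W_A_def i simple_gen_def)
    show "h x \<le> k \<longleftrightarrow> x \<le> k"
      using i by (auto simp: simple_gen_def Transposition.transpose_def)
  qed
  have "h x \<le> k \<longleftrightarrow> x \<le> k" if "h \<in> generate (W_A n) J" for h x
    using that
  proof (induction arbitrary: x)
    case (inv h)
    then show ?case unfolding gen(1)[OF inv] by (rule gen(2))
  qed (simp_all add: gen(2) W_A_def sym_group_one sym_group_mult)
  with k(1) show thesis using that by blast
qed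

text \<open>Conjugating the transposition of \<open>i\<close> and \<open>j\<close> by
  \<open>simple_gen j\<close> gives that of \<open>i\<close> and \<open>j + 1\<close>. Only
  generators with index from \<open>i\<close> to \<open>j - 1\<close> enter, and \<open>k\<close> is
  not among these.\<close>

lemma transpose_in_generate:
  assumes "1 \<le> i" "i < j" "j \<le> n + 1" "\<not> (i \<le> k \<and> k < j)"
  shows "Transposition.transpose i j \<in> generate (W_A n) (simple_gens_A n - {simple_gen k})"
proof -
  have adjacent: "Transposition.transpose j (Suc j) \<in> generate (W_A n) (simple_gens_A n - {simple_gen k})"
    if "1 \<le> j" "j \<le> n" "j \<noteq> k" for j
  proof (rule generate.incl)
    have "simple_gen j \<in> simple_gens_A n - {simple_gen k}"
      using that by (simp add: simple_gens_A_def simple_gen_eq_iff)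
    then show "Transposition.transpose j (Suc j) \<in> simple_gens_A n - {simple_gen k}"
      by (simp add: simple_gen_def)
  qed
  have "Suc i \<le> j" using assms by simp
  then show ?thesis using assms(1,3,4)
  proof (induction j rule: dec_induct)
    case base
    then show ?case using adjacent[of i] by auto
  next
    case (step j)
    let ?s = "Transposition.transpose j (Suc j)"
    have "Transposition.transpose i j \<in> generate (W_A n) (simple_gens_A n - {simple_gen k})"
      using step by auto
    moreover have "?s \<in> generate (W_A n) (simple_gens_A n - {simple_gen k})"
      using step by (intro adjacent) auto
    ultimately have "?s \<otimes>\<^bsub>W_A n\<^esub> (Transposition.transpose i j \<otimes>\<^bsub>W_A n\<^esub> ?s)
        \<in> generate (W_A n) (simple_gens_A n - {simple_gen k})"
      by (intro generate.eng)
    moreover have "?s \<otimes>\<^bsub>W_A n\<^esub> (Transposition.transpose i j \<otimes>\<^bsub>W_A n\<^esub> ?s)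
        = Transposition.transpose i (Suc j)"
      using step by (auto simp: W_A_def sym_group_mult fun_eq_iff Transposition.transpose_def)
    ultimately show ?case by simp
  qed
qed

text \<open>An element of a proper parabolic subgroup preserves some initial segment up to
  \<open>k\<close>, with \<open>k\<close> from 1 to \<open>n\<close>, so its cycles cannot join 1 to
  \<open>n + 1\<close>. Conversely, if 1 and \<open>n + 1\<close> are in different cycles, the
  maximum \<open>k\<close> of the cycle of 1 yields a generator that a word for \<open>w\<close> can
  avoid.\<close>

lemma NC_pos_A_iff:
  assumes "w \<in> NC_A n"
  shows "w \<in> NC_pos_A n \<longleftrightarrow> n + 1 \<in> orbit w 1"
proof
  assume orbit: "n + 1 \<in> orbit w 1"
  have "w \<notin> generate (W_A n) J" if J: "J \<subset> simple_gens_A n" for J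
  proof
    assume w: "w \<in> generate (W_A n) J"
    obtain k where k: "k \<in> {1..n}"
      "\<And>h x. h \<in> generate (W_A n) J \<Longrightarrow> h x \<le> k \<longleftrightarrow> x \<le> k"
      using generate_stabilises[OF J] by blast
    have "(n + 1 \<le> k) = (1 \<le> k)"
      using orbit_invariant[of "\<lambda>x. x \<le> k" w "n + 1" 1] k(2)[OF w] orbit by blast
    with k(1) show False by simp
  qed
  with assms show "w \<in> NC_pos_A n" by (simp add: NC_pos_A_def)
next
  assume pos: "w \<in> NC_pos_A n"
  show "n + 1 \<in> orbit w 1"
  proof (rule ccontr)
    assume not_in: "n + 1 \<notin> orbit w 1"
    have w: "w permutes {1..n+1}" using assms by (simp add: NC_A_iff)
    note perm = permutes_permutation[OF w]
    have sub: "orbit w 1 \<subseteq> {1..n+1}" using permutes_orbit_subset[OF w] by simp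
    then have fin: "finite (orbit w 1)" using finite_subset by blast
    define k where "k = Max (orbit w 1)"
    have k_in: "k \<in> orbit w 1"
      unfolding k_def using fin orbit_nonempty by (rule Max_in)
    have k_max: "x \<le> k" if "x \<in> orbit w 1" for x
      unfolding k_def using fin that by (rule Max_ge)
    have "k \<noteq> n + 1" using k_in not_in by metis
    then have k: "k \<in> {1..n}" using k_in sub by force
    \<comment> \<open>A cycle with points on both sides of the gap behind \<open>k\<close> differs
      from the cycle of 1 and would cross it, through \<open>1 < i < k < j\<close>.\<close>
    have separated: "\<not> (i \<le> k \<and> k < j)"
      if ij: "1 \<le> i" "i < j" "j \<le> n + 1" "orbit w i = orbit w j" for i j
    proof
      assume ikj: "i \<le> k \<and> k < j"
      have "j \<notin> orbit w 1" using k_max[of j] ikj by auto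
      then have neq: "orbit w i \<noteq> orbit w 1"
        using ij(4) orbit_eq_iff[OF perm] by metis
      then have "i \<noteq> 1" "i \<noteq> k" using k_in orbit_eq_iff[OF perm] by metis+
      then have "1 < i" "i < k" "k < j" using ij(1) ikj by auto
      moreover have "1 \<in> orbit w 1" "i \<in> orbit w i" "j \<in> orbit w i"
        using permutation_self_in_orbit[OF perm] ij(4) by auto
      moreover have "orbit w 1 \<in> cycle_partition (n+1) w" "orbit w i \<in> cycle_partition (n+1) w"
        using ij by (auto simp: cycle_partition_def)
      moreover have "noncrossing (cycle_partition (n+1) w)"
        using cycle_partition_NC[OF assms] by (simp add: NC_def)
      ultimately show False
        using k_in neq unfolding noncrossing_def by blast
    qed
    \<comment> \<open>The letters of this word exchange points of a common cycle of
      \<open>w\<close>. By \<open>separated\<close> each of them lies in the parabolic subgroup that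
      omits \<open>simple_gen k\<close>.\<close>
    obtain ws where ws: "set ws \<subseteq> {Transposition.transpose i j | i j.
        1 \<le> i \<and> i < j \<and> j \<le> n + 1 \<and> orbit w i = orbit w j}" "word_prod (W_A n) ws = w"
      using exists_short_word[OF w] by blast
    let ?J = "simple_gens_A n - {simple_gen k}"
    have "set ws \<subseteq> generate (W_A n) ?J"
      using ws(1) separated transpose_in_generate by blast
    then have "word_prod (W_A n) ws \<in> generate (W_A n) ?J"
      by (induction ws) (auto simp: word_prod_def intro: generate.intros)
    moreover have "?J \<subset> simple_gens_A n"
      using k by (auto simp: simple_gens_A_def)
    ultimately show False
      using pos ws(2) by (auto simp: NC_pos_A_def)
  qed
qed

text \<open>This removes permutations from the problem: what remains concerns set partitions
  only.\<close>

lemma NC_pos_eq: "NC_pos (n+1) = {Q \<in> NC (n+1). \<exists>B\<in>Q. 1 \<in> B \<and> n + 1 \<in> B}"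
proof (intro subset_antisym subsetI)
  fix Q assume "Q \<in> NC_pos (n+1)"
  then obtain w where w: "w \<in> NC_pos_A n" "Q = cycle_partition (n+1) w"
    by (auto simp: NC_pos_def)
  then have wA: "w \<in> NC_A n" by (simp add: NC_pos_A_def)
  then have "permutation w" by (auto simp: NC_A_iff intro: permutes_permutation)
  then have "1 \<in> orbit w 1" by (rule permutation_self_in_orbit)
  moreover have "orbit w 1 \<in> Q" using w by (auto simp: cycle_partition_def)
  ultimately show "Q \<in> {Q \<in> NC (n+1). \<exists>B\<in>Q. 1 \<in> B \<and> n + 1 \<in> B}"
    using NC_pos_A_iff[OF wA] w cycle_partition_NC[OF wA] by blast
next
  fix Q assume "Q \<in> {Q \<in> NC (n+1). \<exists>B\<in>Q. 1 \<in> B \<and> n + 1 \<in> B}"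
  then obtain B where Q: "Q \<in> NC (n+1)" "B \<in> Q" "1 \<in> B" "n + 1 \<in> B" by blast
  obtain w where w: "w \<in> NC_A n" "cycle_partition (n+1) w = Q"
    using NC_is_cycle_partition[OF Q(1)] by blast
  then have perm: "permutation w" by (auto simp: NC_A_iff intro: permutes_permutation)
  obtain x where "B = orbit w x" using Q w by (auto simp: cycle_partition_def)
  then have "n + 1 \<in> orbit w 1" using Q orbit_eq_iff[OF perm] by metis
  then have "w \<in> NC_pos_A n" using NC_pos_A_iff[OF w(1)] by blast
  then show "Q \<in> NC_pos (n+1)" using w by (auto simp: NC_pos_def)
qed

section \<open>Adding the last point to the block of 1 and deleting it again\<close>

text \<open>The new point can only be the largest of four crossing points. It then represents the
  block of 1, so 1 can replace it as the smallest point: the crossing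
  \<open>a < b < c < n + 1\<close> becomes \<open>1 < a < b < c\<close>, which was already a
  crossing in \<open>P\<close>.\<close>

lemma add_to_first_block_NC:
  assumes "n \<ge> 1" "P \<in> NC n"
  shows "add_to_first_block n P \<in> {Q \<in> NC (n+1). \<exists>B\<in>Q. 1 \<in> B \<and> n + 1 \<in> B}"
proof -
  define e where "e B = (if 1 \<in> B then B \<union> {n + 1} else B)" for B
  have f: "add_to_first_block n P = e ` P"
    by (simp add: add_to_first_block_def e_def)
  have part: "partition_on {1..n} P" and nc: "noncrossing P"
    using assms by (auto simp: NC_def)
  have union: "\<Union>P = {1..n}" using part by (simp add: partition_on_def)
  have uniq: "B = B'" if "B \<in> P" "B' \<in> P" "x \<in> B" "x \<in> B'" for B B' x
    using that part unfolding partition_on_def disjoint_def by blast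
  have in_P: "x \<in> {1..n}" if "x \<in> B" "B \<in> P" for x B using that union by blast
  have e_iff: "x \<in> e B \<longleftrightarrow> x \<in> B \<or> x = n + 1 \<and> 1 \<in> B" for x B
    by (auto simp: e_def)
  have "1 \<in> \<Union>P" using union assms(1) by simp
  then obtain B1 where B1: "B1 \<in> P" "1 \<in> B1" by blast
  have union_e: "\<Union>(e ` P) = {1..n+1}"
  proof -
    have "\<Union>(e ` P) = insert (n+1) (\<Union>P)" using B1 by (auto simp: e_iff)
    also have "\<dots> = {1..n+1}" unfolding union by auto
    finally show ?thesis .
  qed
  have empty_e: "{} \<notin> e ` P"
    using partition_onD3[OF part] by (auto simp: e_def)
  have e_uniq: "e B = e B'" if "B \<in> P" "B' \<in> P" "x \<in> e B" "x \<in> e B'" for B B' x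
  proof -
    have "B = B'"
      using that in_P[of "n + 1"] uniq[of B B'] unfolding e_iff by auto
    then show ?thesis by simp
  qed
  have "disjnt C C'" if "C \<in> e ` P" "C' \<in> e ` P" "C \<noteq> C'" for C C'
    using that e_uniq unfolding disjnt_iff by blast
  with union_e empty_e have "partition_on {1..n+1} (e ` P)"
    by (intro partition_onI)
  moreover have "e B = e B'" if B: "B \<in> P" "B' \<in> P"
    and abcd: "a < b" "b < c" "c < d" "a \<in> e B" "c \<in> e B" "b \<in> e B'" "d \<in> e B'" for a b c d B B'
  proof -
    have "d \<le> n + 1" using abcd B in_P unfolding e_iff by fastforce
    then have small: "a \<in> B" "c \<in> B" "b \<in> B'" using abcd unfolding e_iff by auto
    have "B = B'"
    proof (cases "d = n + 1")
      case True
      then have one: "1 \<in> B'" using abcd B in_P[of d] unfolding e_iff by auto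
      show ?thesis
      \<comment> \<open>For \<open>a = 1\<close> both blocks contain 1. Otherwise 1 and
        \<open>b\<close> in \<open>B'\<close> interleave with \<open>a\<close> and \<open>c\<close>
        in \<open>B\<close>.\<close>
      proof (cases "a = 1")
        case True
        then show ?thesis using uniq[OF B] one small by blast
      next
        case False
        then have "1 < a" using in_P[of a] small B by fastforce
        then have "B' = B"
          using nc one small abcd B unfolding noncrossing_def by blast
        then show ?thesis by simp
      qed
    next
      case False
      then have "d \<in> B'" using abcd unfolding e_iff by blast
      then show ?thesis using nc small abcd B unfolding noncrossing_def by blast
    qed
    then show ?thesis by simp
  qed
  then have "noncrossing (e ` P)"
    unfolding noncrossing_def by blast
  moreover have "1 \<in> e B1" "n + 1 \<in> e B1" using B1 by (auto simp: e_iff)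
  ultimately show ?thesis
    unfolding f NC_def using B1 by blast
qed

text \<open>Since \<open>n + 1\<close> shares its block with 1, and \<open>1 < n + 1\<close>, its
  deletion empties no block. The block to which it must be restored is still recognised by
  1.\<close>

lemma remove_last_NC:
  assumes "n \<ge> 1" "Q \<in> NC (n+1)" "B1 \<in> Q" "1 \<in> B1" "n + 1 \<in> B1"
  shows "(\<lambda>B. B - {n + 1}) ` Q \<in> NC n"
    and "add_to_first_block n ((\<lambda>B. B - {n + 1}) ` Q) = Q"
proof -
  have part: "partition_on {1..n+1} Q" and nc: "noncrossing Q"
    using assms by (auto simp: NC_def)
  have union: "\<Union>Q = {1..n+1}" using part by (simp add: partition_on_def)
  have uniq: "B = B'" if "B \<in> Q" "B' \<in> Q" "x \<in> B" "x \<in> B'" for B B' x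
    using that part unfolding partition_on_def disjoint_def by blast
  have last_iff: "n + 1 \<in> B \<longleftrightarrow> 1 \<in> B" if "B \<in> Q" for B
    using uniq[OF that assms(3)] assms(4,5) by blast
  have "\<Union>((\<lambda>B. B - {n + 1}) ` Q) = {1..n}"
  proof -
    have "\<Union>((\<lambda>B. B - {n + 1}) ` Q) = \<Union>Q - {n + 1}" by blast
    also have "\<dots> = {1..n}" unfolding union by auto
    finally show ?thesis .
  qed
  moreover have "{} \<notin> (\<lambda>B. B - {n + 1}) ` Q"
  proof
    assume "{} \<in> (\<lambda>B. B - {n + 1}) ` Q"
    then obtain B where B: "B \<in> Q" "B \<subseteq> {n + 1}" by blast
    then have "B = {n + 1}" using partition_onD3[OF part] by (metis subset_singletonD)
    then show False using last_iff[OF B(1)] assms(1) by simp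
  qed
  moreover have "disjnt C C'"
    if "C \<in> (\<lambda>B. B - {n + 1}) ` Q" "C' \<in> (\<lambda>B. B - {n + 1}) ` Q" "C \<noteq> C'" for C C'
    using that uniq unfolding disjnt_iff by blast
  ultimately have "partition_on {1..n} ((\<lambda>B. B - {n + 1}) ` Q)"
    by (intro partition_onI)
  moreover have "noncrossing ((\<lambda>B. B - {n + 1}) ` Q)"
    unfolding noncrossing_def
  proof (intro allI ballI impI; elim imageE conjE)
    fix a b c d C C' B B'
    assume "B \<in> Q" "B' \<in> Q" and C: "C = B - {n + 1}" "C' = B' - {n + 1}"
      and "a < b" "b < c" "c < d" "a \<in> C" "c \<in> C" "b \<in> C'" "d \<in> C'"
    then have "B = B'" using nc unfolding noncrossing_def by blast
    then show "C = C'" using C by simp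
  qed
  ultimately show "(\<lambda>B. B - {n + 1}) ` Q \<in> NC n" by (simp add: NC_def)
  have "(if 1 \<in> B - {n + 1} then (B - {n + 1}) \<union> {n + 1} else B - {n + 1}) = B"
    if "B \<in> Q" for B
    using last_iff[OF that] assms(1) by auto
  then have "add_to_first_block n ((\<lambda>B. B - {n + 1}) ` Q) = (\<lambda>B. B) ` Q"
    unfolding add_to_first_block_def image_image by (intro image_cong) auto
  then show "add_to_first_block n ((\<lambda>B. B - {n + 1}) ` Q) = Q" by simp
qed

lemma remove_last_add_to_first_block:
  assumes "P \<in> NC n"
  shows "(\<lambda>B. B - {n + 1}) ` add_to_first_block n P = P"
proof -
  have "\<Union>P = {1..n}" using assms by (simp add: NC_def partition_on_def)
  moreover have "n + 1 \<notin> {1..n}" by simp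
  ultimately have "n + 1 \<notin> B" if "B \<in> P" for B
    using that by blast
  then have "(if 1 \<in> B then B \<union> {n + 1} else B) - {n + 1} = B" if "B \<in> P" for B
    using that by simp
  then have "(\<lambda>B. B - {n + 1}) ` add_to_first_block n P = (\<lambda>B. B) ` P"
    unfolding add_to_first_block_def image_image by (intro image_cong) auto
  then show ?thesis by simp
qed

theorem proposition7p6:
  fixes n :: nat
  assumes "n \<ge> 1"
  shows "(\<forall>P \<in> NC n. add_to_first_block n P \<in> NC (n + 1) \<and> add_to_first_block n P \<in> NC_pos (n + 1))
       \<and> bij_betw (add_to_first_block n) (NC n) (NC_pos (n + 1))"
proof
  show "\<forall>P \<in> NC n. add_to_first_block n P \<in> NC (n + 1) \<and> add_to_first_block n P \<in> NC_pos (n + 1)"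
    unfolding NC_pos_eq using add_to_first_block_NC[OF assms] by blast
  show "bij_betw (add_to_first_block n) (NC n) (NC_pos (n + 1))"
    unfolding NC_pos_eq
  proof (rule bij_betw_byWitness[where f' = "\<lambda>Q. (\<lambda>B. B - {n + 1}) ` Q"])
    show "\<forall>P\<in>NC n. (\<lambda>B. B - {n + 1}) ` add_to_first_block n P = P"
      using remove_last_add_to_first_block by blast
    show "add_to_first_block n ` NC n \<subseteq> {Q \<in> NC (n+1). \<exists>B\<in>Q. 1 \<in> B \<and> n + 1 \<in> B}"
      using add_to_first_block_NC[OF assms] by blast
    show "\<forall>Q\<in>{Q \<in> NC (n+1). \<exists>B\<in>Q. 1 \<in> B \<and> n + 1 \<in> B}.
        add_to_first_block n ((\<lambda>B. B - {n + 1}) ` Q) = Q"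
      using remove_last_NC(2)[OF assms] by blast
    show "(\<lambda>Q. (\<lambda>B. B - {n + 1}) ` Q) ` {Q \<in> NC (n+1). \<exists>B\<in>Q. 1 \<in> B \<and> n + 1 \<in> B} \<subseteq> NC n"
      using remove_last_NC(1)[OF assms] by blast
  qed
qed

end
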